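(* Let $(L,[\cdot,\cdot],\zeta,\varepsilon)$ be a Hom-Lie color algebra graded by the abelian group $\Gamma$, and let $\sigma:\Gamma\times\Gamma\to\mathbb{F}^*$ be a symmetric multiplier on $\Gamma$. Then the $\sigma$-twist $(L^\sigma,[\cdot,\cdot]^\sigma,\zeta,\varepsilon)$ is also a Hom-Lie color algebra, with the same twisting map $\zeta$.
   Context: Throughout, $\mathbb{F}$ is a field of characteristic zero, $\Gamma$ is an abelian group (written additively), and all vector spaces are over $\mathbb{F}$. A $\Gamma$-graded vector space is $V=\bigoplus_{\alpha\in\Gamma}V_\alpha$; $\bar x\in\Gamma$ denotes the degree of a homogeneous element $x$. A linear map is even if it preserves degrees; a bilinear product on $V$ is even if it maps $V_\alpha\times V_\beta$ into $V_{\alpha+\beta}$. A bi-character on $\Gamma$ is a map $\varepsilon:\Gamma\times\Gamma\to\mathbb{F}^*$ with $\varepsilon(\alpha,\beta)\varepsilon(\beta,\alpha)=1$, $\varepsilon(\alpha,\beta+\gamma)=\varepsilon(\alpha,\beta)\varepsilon(\alpha,\gamma)$, $\varepsilon(\alpha+\beta,\gamma)=\varepsilon(\alpha,\gamma)\varepsilon(\beta,\gamma)$. For homogeneous $x,y$ write $\varepsilon(x,y)=\varepsilon(\bar x,\bar y)$ and $\sigma(x,y)=\sigma(\bar x,\bar y)$. The symbol $\circlearrowleft_{x,y,z}$ denotes summation over the cyclic permutations of $x,y,z$. A Hom-Lie color algebra $(L,[\cdot,\cdot],\zeta,\varepsilon)$ consists of a $\Gamma$-graded space $L$, an even bilinear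 map $[\cdot,\cdot]:L\times L\to L$, an (even) algebra homomorphism $\zeta:L\to L$ (i.e. $\zeta([x,y])=[\zeta(x),\zeta(y)]$), and a bi-character $\varepsilon$ on $\Gamma$, such that for all homogeneous $x,y,z\in L$: $[x,y]=-\varepsilon(x,y)[y,x]$ and $\circlearrowleft_{x,y,z}\varepsilon(z,x)[\zeta(x),[y,z]]=0$. For a map $\sigma:\Gamma\times\Gamma\to\mathbb{F}^*$, the $\sigma$-twist $L^\sigma$ of $L$ is the $\Gamma$-graded vector space $L$ with the bilinear multiplication determined by $[x,y]^\sigma=\sigma(x,y)[x,y]$ for homogeneous $x,y\in L$. The map $\sigma$ is called a symmetric multiplier on $\Gamma$ if (I) $\sigma(\beta,\gamma)=\sigma(\gamma,\beta)$ for all $\beta,\gamma\in\Gamma$, and (II) $\sigma(\alpha,\beta)\sigma(\gamma,\alpha+\beta)$ is invariant under cyclic permutations of $\alpha,\beta,\gamma\in\Gamma$. *)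

theory Defs
  imports Complex_Main
begin

definition bicharacter :: "('g::ab_group_add \<Rightarrow> 'g \<Rightarrow> 'k::field) \<Rightarrow> bool" where
  "bicharacter \<epsilon> \<longleftrightarrow>
     (\<forall>\<alpha> \<beta>. \<epsilon> \<alpha> \<beta> \<noteq> 0) \<and>
     (\<forall>\<alpha> \<beta>. \<epsilon> \<alpha> \<beta> * \<epsilon> \<beta> \<alpha> = 1) \<and>
     (\<forall>\<alpha> \<beta> \<gamma>. \<epsilon> \<alpha> (\<beta> + \<gamma>) = \<epsilon> \<alpha> \<beta> * \<epsilon> \<alpha> \<gamma>) \<and>
     (\<forall>\<alpha> \<beta> \<gamma>. \<epsilon> (\<alpha> + \<beta>) \<gamma> = \<epsilon> \<alpha> \<gamma> * \<epsilon> \<beta> \<gamma>)"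

definition symmetric_multiplier :: "('g::ab_group_add \<Rightarrow> 'g \<Rightarrow> 'k::field) \<Rightarrow> bool" where
  "symmetric_multiplier \<sigma> \<longleftrightarrow>
     (\<forall>\<alpha> \<beta>. \<sigma> \<alpha> \<beta> \<noteq> 0) \<and>
     (\<forall>\<beta> \<gamma>. \<sigma> \<beta> \<gamma> = \<sigma> \<gamma> \<beta>) \<and>
     (\<forall>\<alpha> \<beta> \<gamma>. \<sigma> \<alpha> \<beta> * \<sigma> \<gamma> (\<alpha> + \<beta>) = \<sigma> \<beta> \<gamma> * \<sigma> \<alpha> (\<beta> + \<gamma>))"

definition homogeneous_decomposition ::
    "('g \<Rightarrow> 'v::ab_group_add set) \<Rightarrow> 'v \<Rightarrow> ('g \<Rightarrow> 'v) \<Rightarrow> bool" where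
  "homogeneous_decomposition V x f \<longleftrightarrow>
     finite {\<alpha>. f \<alpha> \<noteq> 0} \<and> (\<forall>\<alpha>. f \<alpha> \<in> V \<alpha>) \<and> x = (\<Sum>\<alpha> | f \<alpha> \<noteq> 0. f \<alpha>)"

definition component :: "('g \<Rightarrow> 'v::ab_group_add set) \<Rightarrow> 'v \<Rightarrow> 'g \<Rightarrow> 'v" where
  "component V x = (THE f. homogeneous_decomposition V x f)"

locale graded_vector_space = vector_space scale
  for scale :: "'k::field_char_0 \<Rightarrow> 'v::ab_group_add \<Rightarrow> 'v" (infixr "*s" 75) +
  fixes V :: "'g::ab_group_add \<Rightarrow> 'v set"
  assumes subspace_grade: "subspace (V \<alpha>)"
    and direct_sum: "\<exists>!f. homogeneous_decomposition V x f"

text \<open>The zero vector lies in every \<open>V \<alpha>\<close>, so it has no well-defined degree. The laws for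
  homogeneous elements therefore quantify over degrees \<open>\<alpha>\<close> and elements of \<open>V \<alpha>\<close>;
  they hold trivially when one of the elements is zero.\<close>

locale hom_lie_color_algebra = graded_vector_space scale V
  for scale :: "'k::field_char_0 \<Rightarrow> 'v::ab_group_add \<Rightarrow> 'v" (infixr "*s" 75)
    and V :: "'g::ab_group_add \<Rightarrow> 'v set" +
  fixes br :: "'v \<Rightarrow> 'v \<Rightarrow> 'v"
    and \<zeta> :: "'v \<Rightarrow> 'v"
    and \<epsilon> :: "'g \<Rightarrow> 'g \<Rightarrow> 'k"
  assumes bicharacter: "bicharacter \<epsilon>"
    and linear_right: "Vector_Spaces.linear scale scale (\<lambda>y. br x y)"
    and linear_left: "Vector_Spaces.linear scale scale (\<lambda>x. br x y)"
    and even_bracket: "x \<in> V \<alpha> \<Longrightarrow> y \<in> V \<beta> \<Longrightarrow> br x y \<in> V (\<alpha> + \<beta>)"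
    and linear_twisting: "Vector_Spaces.linear scale scale \<zeta>"
    and even_twisting: "x \<in> V \<alpha> \<Longrightarrow> \<zeta> x \<in> V \<alpha>"
    and hom_twisting: "\<zeta> (br x y) = br (\<zeta> x) (\<zeta> y)"
    and color_skew_symmetry:
      "x \<in> V \<alpha> \<Longrightarrow> y \<in> V \<beta> \<Longrightarrow> br x y = - (\<epsilon> \<alpha> \<beta> *s br y x)"
    and hom_jacobi:
      "x \<in> V \<alpha> \<Longrightarrow> y \<in> V \<beta> \<Longrightarrow> z \<in> V \<gamma> \<Longrightarrow>
         \<epsilon> \<gamma> \<alpha> *s br (\<zeta> x) (br y z)
       + \<epsilon> \<alpha> \<beta> *s br (\<zeta> y) (br z x)
       + \<epsilon> \<beta> \<gamma> *s br (\<zeta> z) (br x y) = 0"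

text \<open>The rule \<open>\<sigma> \<alpha> \<beta> *s br x y\<close> on homogeneous elements of degrees \<open>\<alpha>\<close>, \<open>\<beta>\<close> is extended
  bilinearly through the homogeneous components; \<open>twisted_bracket_homogeneous\<close> and
  \<open>twisted_bracket_unique\<close> below confirm that this is the bilinear map determined by that rule.\<close>

definition twisted_bracket ::
    "('k::field_char_0 \<Rightarrow> 'v::ab_group_add \<Rightarrow> 'v) \<Rightarrow> ('g::ab_group_add \<Rightarrow> 'v set) \<Rightarrow>
     ('g \<Rightarrow> 'g \<Rightarrow> 'k) \<Rightarrow> ('v \<Rightarrow> 'v \<Rightarrow> 'v) \<Rightarrow> 'v \<Rightarrow> 'v \<Rightarrow> 'v" where
  "twisted_bracket scale V \<sigma> br x y =
     (\<Sum>\<alpha> | component V x \<alpha> \<noteq> 0. \<Sum>\<beta> | component V y \<beta> \<noteq> 0.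
        scale (\<sigma> \<alpha> \<beta>) (br (component V x \<alpha>) (component V y \<beta>)))"

context graded_vector_space
begin

lemma component_decomposition: "homogeneous_decomposition V x (component V x)"
  unfolding component_def by (rule theI'[OF direct_sum])

lemma component_homogeneous:
  assumes "x \<in> V \<alpha>"
  shows "component V x = (\<lambda>\<gamma>. if \<gamma> = \<alpha> then x else 0)"
proof -
  have "{\<gamma>. (if \<gamma> = \<alpha> then x else 0) \<noteq> 0} = (if x = 0 then {} else {\<alpha>})"
    by auto
  then have "homogeneous_decomposition V x (\<lambda>\<gamma>. if \<gamma> = \<alpha> then x else 0)"
    using assms subspace_0[OF subspace_grade]
    by (auto simp: homogeneous_decomposition_def)
  then show ?thesis
    using direct_sum[of x] component_decomposition[of x] by blast
qed

end

context hom_lie_color_algebra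
begin

lemma twisted_bracket_homogeneous:
  assumes "x \<in> V \<alpha>" "y \<in> V \<beta>"
  shows "twisted_bracket scale V \<sigma> br x y = \<sigma> \<alpha> \<beta> *s br x y"
proof -
  have supp: "{\<gamma>. (if \<gamma> = \<delta> then u else 0) \<noteq> 0} = (if u = 0 then {} else {\<delta>})"
    for \<delta> :: 'g and u :: 'v by auto
  interpret l: Vector_Spaces.linear scale scale "\<lambda>x. br x y" by (rule linear_left)
  interpret r: Vector_Spaces.linear scale scale "\<lambda>y. br x y" by (rule linear_right)
  show ?thesis
    using l.zero r.zero
    unfolding twisted_bracket_def component_homogeneous[OF assms(1)]
      component_homogeneous[OF assms(2)] supp
    by auto
qed

lemma twisted_bracket_unique:
  assumes "\<And>x. Vector_Spaces.linear scale scale (\<lambda>y. m x y)"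
    and "\<And>y. Vector_Spaces.linear scale scale (\<lambda>x. m x y)"
    and "\<And>\<alpha> \<beta> x y. x \<in> V \<alpha> \<Longrightarrow> y \<in> V \<beta> \<Longrightarrow> m x y = \<sigma> \<alpha> \<beta> *s br x y"
  shows "m = twisted_bracket scale V \<sigma> br"
proof (intro ext)
  fix x y
  interpret l: Vector_Spaces.linear scale scale "\<lambda>x. m x y" by (rule assms(2))
  let ?X = "{\<alpha>. component V x \<alpha> \<noteq> 0}" and ?Y = "{\<beta>. component V y \<beta> \<noteq> 0}"
  have mem: "component V u \<alpha> \<in> V \<alpha>" and dec: "u = (\<Sum>\<alpha> | component V u \<alpha> \<noteq> 0. component V u \<alpha>)"
    for u \<alpha>
    using component_decomposition[of u] unfolding homogeneous_decomposition_def by auto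
  have "m x y = m (\<Sum>\<alpha>\<in>?X. component V x \<alpha>) y"
    using dec[of x] by simp
  also have "\<dots> = (\<Sum>\<alpha>\<in>?X. m (component V x \<alpha>) y)"
    by (rule l.sum)
  also have "\<dots> = (\<Sum>\<alpha>\<in>?X. \<Sum>\<beta>\<in>?Y. m (component V x \<alpha>) (component V y \<beta>))"
  proof (rule sum.cong[OF refl])
    fix \<alpha>
    interpret r: Vector_Spaces.linear scale scale "\<lambda>y. m (component V x \<alpha>) y"
      by (rule assms(1))
    have "m (component V x \<alpha>) y = m (component V x \<alpha>) (\<Sum>\<beta>\<in>?Y. component V y \<beta>)"
      using dec[of y] by simp
    also have "\<dots> = (\<Sum>\<beta>\<in>?Y. m (component V x \<alpha>) (component V y \<beta>))"
      by (rule r.sum)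
    finally show "m (component V x \<alpha>) y
        = (\<Sum>\<beta>\<in>?Y. m (component V x \<alpha>) (component V y \<beta>))" .
  qed
  also have "\<dots> = twisted_bracket scale V \<sigma> br x y"
    unfolding twisted_bracket_def by (intro sum.cong refl assms(3) mem)
  finally show "m x y = twisted_bracket scale V \<sigma> br x y" .
qed

end

end

theory Submission
  imports Defs
begin

text \<open>On homogeneous elements the twist only rescales the bracket by \<open>\<sigma>\<close>.
  Symmetry of \<open>\<sigma>\<close> puts the same factor on both sides of skew-symmetry
  (\<open>twisted_color_skew_symmetry\<close>). In the Jacobi sum, \<zeta> preserves degrees and the
  inner bracket has the sum of two degrees, so each nested term acquires a factor \<open>\<sigma>
  \<beta> \<gamma> * \<sigma> \<alpha> (\<beta> + \<gamma>)\<close> up to rotation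
  (\<open>twisted_bracket_nested\<close>). The cyclic condition makes the three factors equal, and
  the twisted sum is a multiple of the original one, hence zero (\<open>twisted_hom_jacobi\<close>).

  Bilinearity and compatibility with \<zeta> concern arbitrary elements, where the twist is a double
  sum over homogeneous components. They follow because taking components commutes with addition and
  with even linear maps (\<open>component_add\<close>, \<open>component_even_linear\<close>), once
  the sums run over common index sets.\<close>

context graded_vector_space
begin

lemma component_mem: "component V x \<alpha> \<in> V \<alpha>"
  using component_decomposition[of x] unfolding homogeneous_decomposition_def by blast

lemma finite_support_component: "finite {\<alpha>. component V x \<alpha> \<noteq> 0}"
  using component_decomposition[of x] unfolding homogeneous_decomposition_def by blast

lemma sum_component:
  assumes "finite A" "{\<alpha>. component V x \<alpha> \<noteq> 0} \<subseteq> A"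
  shows "(\<Sum>\<alpha>\<in>A. component V x \<alpha>) = x"
proof -
  have "x = (\<Sum>\<alpha> | component V x \<alpha> \<noteq> 0. component V x \<alpha>)"
    using component_decomposition[of x] unfolding homogeneous_decomposition_def by blast
  also have "\<dots> = (\<Sum>\<alpha>\<in>A. component V x \<alpha>)"
    using assms by (intro sum.mono_neutral_left) auto
  finally show ?thesis by simp
qed

text \<open>Uniqueness of the decomposition, in a form where \<open>A\<close> may exceed the support
  of \<open>f\<close>. Exact supports, which cancellation makes awkward, never have to be
  computed.\<close>

lemma component_eqI:
  assumes "finite A" "\<And>\<alpha>. f \<alpha> \<in> V \<alpha>" "\<And>\<alpha>. \<alpha> \<notin> A \<Longrightarrow> f \<alpha> = 0" "x = (\<Sum>\<alpha>\<in>A. f \<alpha>)"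
  shows "component V x = f"
proof -
  have sub: "{\<alpha>. f \<alpha> \<noteq> 0} \<subseteq> A" using assms(3) by blast
  then have "(\<Sum>\<alpha> | f \<alpha> \<noteq> 0. f \<alpha>) = (\<Sum>\<alpha>\<in>A. f \<alpha>)"
    using assms(1) by (intro sum.mono_neutral_left) auto
  then have "homogeneous_decomposition V x f"
    using assms finite_subset[OF sub assms(1)] unfolding homogeneous_decomposition_def by simp
  then show ?thesis
    using direct_sum[of x] component_decomposition[of x] by blast
qed

lemma component_add: "component V (x + y) = (\<lambda>\<alpha>. component V x \<alpha> + component V y \<alpha>)"
proof (rule component_eqI)
  let ?A = "{\<alpha>. component V x \<alpha> \<noteq> 0} \<union> {\<alpha>. component V y \<alpha> \<noteq> 0}"
  show fin: "finite ?A" by (simp add: finite_support_component)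
  show "component V x \<alpha> + component V y \<alpha> \<in> V \<alpha>" for \<alpha>
    by (intro subspace_add subspace_grade component_mem)
  show "x + y = (\<Sum>\<alpha>\<in>?A. component V x \<alpha> + component V y \<alpha>)"
    using sum_component[OF fin, of x] sum_component[OF fin, of y] by (simp add: sum.distrib)
qed auto

text \<open>Applying an even map to each component of \<open>x\<close> gives a homogeneous
  decomposition of \<open>h x\<close>, and there is only one. It serves both for scalings and for
  \<zeta>.\<close>

lemma component_even_linear:
  assumes "Vector_Spaces.linear scale scale h" "\<And>\<alpha> u. u \<in> V \<alpha> \<Longrightarrow> h u \<in> V \<alpha>"
  shows "component V (h x) = (\<lambda>\<alpha>. h (component V x \<alpha>))"
proof (rule component_eqI)
  interpret h: Vector_Spaces.linear scale scale h by (rule assms(1))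
  let ?A = "{\<alpha>. component V x \<alpha> \<noteq> 0}"
  show fin: "finite ?A" by (rule finite_support_component)
  show "h (component V x \<alpha>) \<in> V \<alpha>" for \<alpha> by (intro assms(2) component_mem)
  show "h (component V x \<alpha>) = 0" if "\<alpha> \<notin> ?A" for \<alpha> using that h.zero by simp
  show "h x = (\<Sum>\<alpha>\<in>?A. h (component V x \<alpha>))"
    using sum_component[OF fin, of x] h.sum[of "component V x" ?A] by simp
qed

lemma component_scale: "component V (c *s x) = (\<lambda>\<alpha>. c *s component V x \<alpha>)"
proof (rule component_even_linear)
  show "Vector_Spaces.linear scale scale ((*s) c)"
    by (rule linear_scale_self)
qed (rule subspace_scale[OF subspace_grade])

end

context hom_lie_color_algebra
begin

lemma br_zero: "br 0 y = 0" "br x 0 = 0"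
  and br_add: "br (x + x') y = br x y + br x' y" "br x (y + y') = br x y + br x y'"
  and br_scale: "br (c *s x) y = c *s br x y" "br x (c *s y) = c *s br x y"
proof -
  interpret l: Vector_Spaces.linear scale scale "\<lambda>x. br x y" by (rule linear_left)
  interpret r: Vector_Spaces.linear scale scale "\<lambda>y. br x y" by (rule linear_right)
  show "br 0 y = 0" "br x 0 = 0" by (rule l.zero, rule r.zero)
  show "br (x + x') y = br x y + br x' y" "br x (y + y') = br x y + br x y'"
    by (rule l.add, rule r.add)
  show "br (c *s x) y = c *s br x y" "br x (c *s y) = c *s br x y"
    by (rule l.scale, rule r.scale)
qed

text \<open>Supports shrink under sums, scalings and \<open>\<zeta>\<close>, so comparing two twisted brackets
  requires index sets that are larger than the supports.\<close>

lemma twisted_bracket_superset: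
  assumes "finite A" "{\<alpha>. component V x \<alpha> \<noteq> 0} \<subseteq> A"
    and "finite B" "{\<beta>. component V y \<beta> \<noteq> 0} \<subseteq> B"
  shows "twisted_bracket scale V \<sigma> br x y =
    (\<Sum>\<alpha>\<in>A. \<Sum>\<beta>\<in>B. \<sigma> \<alpha> \<beta> *s br (component V x \<alpha>) (component V y \<beta>))"
proof -
  have inner: "(\<Sum>\<beta> | component V y \<beta> \<noteq> 0. \<sigma> \<alpha> \<beta> *s br (component V x \<alpha>) (component V y \<beta>))
      = (\<Sum>\<beta>\<in>B. \<sigma> \<alpha> \<beta> *s br (component V x \<alpha>) (component V y \<beta>))" for \<alpha>
    using assms(3,4) by (intro sum.mono_neutral_left) (auto simp: br_zero)
  show ?thesis
    unfolding twisted_bracket_def inner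
    using assms(1,2) by (intro sum.mono_neutral_left) (auto simp: br_zero)
qed

text \<open>The factors \<open>\<sigma> \<alpha> \<beta>\<close> depend on degrees only, so over a
  fixed index set every summand is linear in the component of \<open>y\<close>.\<close>

lemma linear_right_twisted_bracket:
  "Vector_Spaces.linear scale scale (\<lambda>y. twisted_bracket scale V \<sigma> br x y)"
proof -
  note fin = finite_support_component
  let ?S = "\<lambda>y. {\<beta>. component V y \<beta> \<noteq> 0}"
  have add: "twisted_bracket scale V \<sigma> br x (y + y') =
    twisted_bracket scale V \<sigma> br x y + twisted_bracket scale V \<sigma> br x y'" for y y'
  proof -
    let ?B = "?S y \<union> ?S y'"
    have B: "finite ?B" by (simp add: fin)
    have "?S (y + y') \<subseteq> ?B" by (auto simp: component_add)
    then show ?thesis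
      using twisted_bracket_superset[where x = x and y = y, OF fin order_refl B]
        twisted_bracket_superset[where x = x and y = y', OF fin order_refl B]
        twisted_bracket_superset[where x = x and y = "y + y'", OF fin order_refl B]
      by (simp add: component_add br_add scale_right_distrib sum.distrib)
  qed
  have "twisted_bracket scale V \<sigma> br x (c *s y) = c *s twisted_bracket scale V \<sigma> br x y" for c y
  proof -
    \<comment> \<open>Only an inclusion, since \<open>c = 0\<close> empties the support.\<close>
    have "?S (c *s y) \<subseteq> ?S y" by (auto simp: component_scale)
    then show ?thesis
      using twisted_bracket_superset[where x = x and y = y, OF fin order_refl fin order_refl]
        twisted_bracket_superset[where x = x and y = "c *s y", OF fin order_refl fin[of y]]
      by (simp add: component_scale br_scale scale_sum_right mult.commute)
  qed
  with add show ?thesis by unfold_locales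
qed

lemma linear_left_twisted_bracket:
  "Vector_Spaces.linear scale scale (\<lambda>x. twisted_bracket scale V \<sigma> br x y)"
proof -
  note fin = finite_support_component
  let ?S = "\<lambda>x. {\<alpha>. component V x \<alpha> \<noteq> 0}"
  have add: "twisted_bracket scale V \<sigma> br (x + x') y =
    twisted_bracket scale V \<sigma> br x y + twisted_bracket scale V \<sigma> br x' y" for x x'
  proof -
    let ?A = "?S x \<union> ?S x'"
    have A: "finite ?A" by (simp add: fin)
    have "?S (x + x') \<subseteq> ?A" by (auto simp: component_add)
    then show ?thesis
      using twisted_bracket_superset[where x = x and y = y, OF A _ fin order_refl]
        twisted_bracket_superset[where x = x' and y = y, OF A _ fin order_refl]
        twisted_bracket_superset[where x = "x + x'" and y = y, OF A _ fin order_refl]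
      by (simp add: component_add br_add scale_right_distrib sum.distrib)
  qed
  have "twisted_bracket scale V \<sigma> br (c *s x) y = c *s twisted_bracket scale V \<sigma> br x y" for c x
  proof -
    have "?S (c *s x) \<subseteq> ?S x" by (auto simp: component_scale)
    then show ?thesis
      using twisted_bracket_superset[where x = x and y = y, OF fin order_refl fin order_refl]
        twisted_bracket_superset[where x = "c *s x" and y = y, OF fin[of x] _ fin order_refl]
      by (simp add: component_scale br_scale scale_sum_right mult.commute)
  qed
  with add show ?thesis by unfold_locales
qed

text \<open>As \<zeta> is even, it maps components to components of the same degree. The factors
  from \<sigma> therefore agree on both sides, and multiplicativity of \<zeta> applies to each
  summand.\<close>

lemma twisting_twisted_bracket:
  "\<zeta> (twisted_bracket scale V \<sigma> br x y) = twisted_bracket scale V \<sigma> br (\<zeta> x) (\<zeta> y)"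
proof -
  interpret z: Vector_Spaces.linear scale scale \<zeta> by (rule linear_twisting)
  note comp = component_even_linear[OF linear_twisting even_twisting]
  \<comment> \<open>\<zeta> may annihilate components, so both sides are indexed by the supports of
    the original arguments.\<close>
  have sub: "{\<alpha>. component V (\<zeta> u) \<alpha> \<noteq> 0} \<subseteq> {\<alpha>. component V u \<alpha> \<noteq> 0}" for u
    using z.zero by (auto simp: comp)
  have "twisted_bracket scale V \<sigma> br (\<zeta> x) (\<zeta> y) =
      (\<Sum>\<alpha> | component V x \<alpha> \<noteq> 0. \<Sum>\<beta> | component V y \<beta> \<noteq> 0.
        \<sigma> \<alpha> \<beta> *s br (\<zeta> (component V x \<alpha>)) (\<zeta> (component V y \<beta>)))"
    using twisted_bracket_superset[OF finite_support_component sub finite_support_component sub]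
    by (simp add: comp)
  also have "\<dots> = \<zeta> (twisted_bracket scale V \<sigma> br x y)"
    unfolding twisted_bracket_def by (simp add: z.sum z.scale hom_twisting)
  finally show ?thesis by simp
qed

lemma even_twisted_bracket:
  assumes "x \<in> V \<alpha>" "y \<in> V \<beta>"
  shows "twisted_bracket scale V \<sigma> br x y \<in> V (\<alpha> + \<beta>)"
  unfolding twisted_bracket_homogeneous[OF assms]
  by (intro subspace_scale subspace_grade even_bracket assms)

text \<open>The inner bracket is homogeneous of degree \<open>\<beta> + \<gamma>\<close>, which
  determines the outer factor.\<close>

lemma twisted_bracket_nested:
  assumes "x \<in> V \<alpha>" "y \<in> V \<beta>" "z \<in> V \<gamma>"
  shows "twisted_bracket scale V \<sigma> br x (twisted_bracket scale V \<sigma> br y z) =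
    (\<sigma> \<beta> \<gamma> * \<sigma> \<alpha> (\<beta> + \<gamma>)) *s br x (br y z)"
  unfolding twisted_bracket_homogeneous[OF assms(1) even_twisted_bracket[OF assms(2,3)]]
  by (simp add: twisted_bracket_homogeneous[OF assms(2,3)] br_scale mult.commute)

lemma twisted_hom_jacobi:
  assumes \<sigma>: "symmetric_multiplier \<sigma>"
    and xyz: "x \<in> V \<alpha>" "y \<in> V \<beta>" "z \<in> V \<gamma>"
  defines "m \<equiv> twisted_bracket scale V \<sigma> br"
  shows "\<epsilon> \<gamma> \<alpha> *s m (\<zeta> x) (m y z) + \<epsilon> \<alpha> \<beta> *s m (\<zeta> y) (m z x) + \<epsilon> \<beta> \<gamma> *s m (\<zeta> z) (m x y) = 0"
proof -
  define k where "k = \<sigma> \<beta> \<gamma> * \<sigma> \<alpha> (\<beta> + \<gamma>)"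
  have cyc: "\<sigma> a b * \<sigma> c (a + b) = \<sigma> b c * \<sigma> a (b + c)" for a b c
    using \<sigma> unfolding symmetric_multiplier_def by blast
  \<comment> \<open>Two rotations of the cyclic condition identify the factors of the other two
    Jacobi terms with that of the first.\<close>
  have k: "\<sigma> \<gamma> \<alpha> * \<sigma> \<beta> (\<gamma> + \<alpha>) = k" "\<sigma> \<alpha> \<beta> * \<sigma> \<gamma> (\<alpha> + \<beta>) = k"
    using cyc[of \<alpha> \<beta> \<gamma>] cyc[of \<beta> \<gamma> \<alpha>] unfolding k_def by simp_all
  have m: "m (\<zeta> x) (m y z) = k *s br (\<zeta> x) (br y z)"
    "m (\<zeta> y) (m z x) = k *s br (\<zeta> y) (br z x)"
    "m (\<zeta> z) (m x y) = k *s br (\<zeta> z) (br x y)"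
    unfolding m_def
    using twisted_bracket_nested[OF even_twisting[OF xyz(1)] xyz(2,3), of \<sigma>]
      twisted_bracket_nested[OF even_twisting[OF xyz(2)] xyz(3,1), of \<sigma>]
      twisted_bracket_nested[OF even_twisting[OF xyz(3)] xyz(1,2), of \<sigma>]
    by (simp_all only: k k_def[symmetric])
  have "\<epsilon> \<gamma> \<alpha> *s m (\<zeta> x) (m y z) + \<epsilon> \<alpha> \<beta> *s m (\<zeta> y) (m z x) + \<epsilon> \<beta> \<gamma> *s m (\<zeta> z) (m x y)
    = k *s (\<epsilon> \<gamma> \<alpha> *s br (\<zeta> x) (br y z) + \<epsilon> \<alpha> \<beta> *s br (\<zeta> y) (br z x)
      + \<epsilon> \<beta> \<gamma> *s br (\<zeta> z) (br x y))"
    unfolding m by (simp add: scale_right_distrib mult.commute)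
  also have "\<dots> = 0" using hom_jacobi[OF xyz] by simp
  finally show ?thesis .
qed

lemma twisted_color_skew_symmetry:
  assumes \<sigma>: "symmetric_multiplier \<sigma>" and xy: "x \<in> V \<alpha>" "y \<in> V \<beta>"
  shows "twisted_bracket scale V \<sigma> br x y = - (\<epsilon> \<alpha> \<beta> *s twisted_bracket scale V \<sigma> br y x)"
proof -
  \<comment> \<open>This equality lets the common factor be pulled out of both brackets.\<close>
  have "\<sigma> \<alpha> \<beta> = \<sigma> \<beta> \<alpha>" using \<sigma> unfolding symmetric_multiplier_def by blast
  then show ?thesis
    using color_skew_symmetry[OF xy]
    by (simp add: twisted_bracket_homogeneous[OF xy] twisted_bracket_homogeneous[OF xy(2,1)]
        scale_left_commute)
qed

end

theorem proposition4p18: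
  fixes scale :: "'k::field_char_0 \<Rightarrow> 'v::ab_group_add \<Rightarrow> 'v"
    and V :: "'g::ab_group_add \<Rightarrow> 'v set"
    and br :: "'v \<Rightarrow> 'v \<Rightarrow> 'v"
    and \<zeta> :: "'v \<Rightarrow> 'v"
    and \<epsilon> \<sigma> :: "'g \<Rightarrow> 'g \<Rightarrow> 'k"
  assumes "hom_lie_color_algebra scale V br \<zeta> \<epsilon>"
    and "symmetric_multiplier \<sigma>"
  shows "hom_lie_color_algebra scale V (twisted_bracket scale V \<sigma> br) \<zeta> \<epsilon>"
proof -
  interpret hom_lie_color_algebra scale V br \<zeta> \<epsilon> by (rule assms(1))
  show ?thesis
    \<comment> \<open>The grading, \<epsilon> and \<zeta> are unchanged, so their own axioms carry
      over; only those involving the bracket need the lemmas above.\<close>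
    by (intro hom_lie_color_algebra.intro hom_lie_color_algebra_axioms.intro
        graded_vector_space_axioms bicharacter linear_right_twisted_bracket
        linear_left_twisted_bracket even_twisted_bracket linear_twisting even_twisting
        twisting_twisted_bracket twisted_color_skew_symmetry[OF assms(2)]
        twisted_hom_jacobi[OF assms(2)])
qed

end
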